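(* Let $X$ be a real or complex Banach space, let $1<p<\infty$ and $\frac1p+\frac1q=1$. Let $(x_i)\in S(\ell^p(X))$ with $x_i\neq 0$ for each $i\in\mathbb{N}$, and let $(x_i^* )\in S_{(x_i)}\subseteq \ell^q(X^* )=\ell^p(X)^*$. Then the identity map $I:(S_{(x_i)},\mathrm{w}^* )\to(S_{(x_i)},\mathrm{w})$ is continuous at $(x_i^* )$ if and only if for each $i\in\mathbb{N}$ the functional $\frac{x_i^*}{\|x_i^*\|}\in S_{\frac{x_i}{\|x_i\|}}$ is a w$^*$-w PC of $S_{\frac{x_i}{\|x_i\|}}$.
   Context: For a Banach space $E$, $S(E)$ is its unit sphere. For $x\in S(E)$ the state space of $x$ is $S_x=\{x^*\in S(E^* ): x^*(x)=1\}$. For $K$ a norm closed bounded subset of the unit ball of $E^*$, a point $x^*\in K$ is a w$^*$-w PC (weak$^*$-weak point of continuity) of $K$ if the identity map $I:(K,\mathrm{w}^* )\to(K,\mathrm{w})$ is continuous at $x^*$, where w$^*$ is the (relative) weak$^*$ topology of $E^*=$ dual of $E$ and w is the (relative) weak topology of $E^*$ (induced by $E^{**}$). $\ell^p(X)=\{(x_i)_{i\in\mathbb{N}}: x_i\in X,\ \sum_i\|x_i\|^p<\infty\}$ with norm $\|(x_i)\|=(\sum_i\|x_i\|^p)^{1/p}$; its dual is identified with $\ell^q(X^* )$ via $(x_i^* )((x_i))=\sum_i x_i^*(x_i)$. *)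

theory Defs
  imports "HOL-Analysis.Analysis" "HOL-Library.Function_Algebras"
begin

text \<open>
  Scalar fields. Up to isometric isomorphism the real and the complex numbers are the only types
  of this class: see the instances and the lemma \<open>real_or_complex_cases\<close>.
\<close>

class real_or_complex = real_normed_field + euclidean_space

instance real :: real_or_complex ..
instance complex :: real_or_complex ..

lemma square_of_orthogonal_unit:
  fixes u :: "'k::real_or_complex"
  assumes "norm u = 1" "inner 1 u = 0"
  shows "u * u = - 1"
proof -
  have n1: "(norm (1 + u))\<^sup>2 = 2" and n2: "(norm (1 - u))\<^sup>2 = 2"
    using assms dot_norm[of 1 u] dot_norm_neg[of 1 u] by auto
  have "(norm ((1 + u) * (1 - u)))\<^sup>2 = 4"
    by (simp add: norm_mult power_mult_distrib n1 n2)
  then have "(norm (1 - u * u))\<^sup>2 = 4"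
    by (simp add: algebra_simps)
  moreover have "norm (u * u) = 1"
    using assms by (simp add: norm_mult)
  ultimately have "inner 1 (u * u) = - 1"
    using dot_norm_neg[of 1 "u * u"] by simp
  then have "(norm (1 + u * u))\<^sup>2 = 0"
    using dot_norm[of 1 "u * u"] \<open>norm (u * u) = 1\<close> by simp
  then show ?thesis
    by (simp add: add_eq_0_iff)
qed

lemma real_or_complex_cases:
  "(\<forall>z::'k::real_or_complex. \<exists>a. z = of_real a) \<or>
   (\<exists>u::'k. u * u = - 1 \<and> (\<forall>z. \<exists>a b. z = of_real a + of_real b * u) \<and>
      (\<forall>a b. norm (of_real a + of_real b * u) = sqrt (a\<^sup>2 + b\<^sup>2)))"
proof (cases "\<forall>z::'k. \<exists>a. z = of_real a")
  case False
  have inner11: "inner (1::'k) 1 = 1"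
    by (simp add: dot_square_norm)
  have split: "\<exists>v. z = of_real (inner 1 z) + of_real (norm w) * v \<and> norm v = 1 \<and> inner 1 v = 0"
    if w: "w = z - of_real (inner 1 z)" "w \<noteq> 0" for z w :: 'k
  proof (intro exI conjI)
    let ?v = "w /\<^sub>R norm w"
    show "z = of_real (inner 1 z) + of_real (norm w) * ?v"
      using w by (simp add: scaleR_conv_of_real mult.assoc[symmetric] flip: of_real_mult of_real_inverse)
    show "norm ?v = 1" using w by simp
    show "inner 1 ?v = 0"
      using w inner11 by (simp add: inner_diff_right of_real_def)
  qed
  from False obtain z0 :: 'k where "\<And>a. z0 \<noteq> of_real a" by blast
  with split[of "z0 - of_real (inner 1 z0)" z0]
  obtain u :: 'k where u: "norm u = 1" "inner 1 u = 0" by auto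
  then have inner_uu: "inner u u = 1" by (simp add: dot_square_norm)
  have uu: "u * u = - 1" by (rule square_of_orthogonal_unit[OF u])
  have "\<exists>a b. z = of_real a + of_real b * u" for z :: 'k
  proof (cases "z = of_real (inner 1 z)")
    case True
    then have "z = of_real (inner 1 z) + of_real 0 * u" by simp
    then show ?thesis by blast
  next
    case False
    then obtain v n where v: "z = of_real (inner 1 z) + of_real n * v" "norm v = 1" "inner 1 v = 0"
      using split[of "z - of_real (inner 1 z)" z] by auto
    have "(v - u) * (v + u) = 0"
      using square_of_orthogonal_unit[OF v(2,3)] uu by (simp add: algebra_simps)
    then have "v = u \<or> v = - u" by (simp add: add_eq_0_iff2)
    then have "z = of_real (inner 1 z) + of_real n * u
        \<or> z = of_real (inner 1 z) + of_real (- n) * u"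
      using v(1) by auto
    then show ?thesis by blast
  qed
  moreover have "norm (of_real a + of_real b * u) = sqrt (a\<^sup>2 + b\<^sup>2)" for a b
  proof -
    have "inner (of_real a + of_real b * u) (of_real a + of_real b * u) = a\<^sup>2 + b\<^sup>2"
      using u(2) inner11 inner_uu
      by (simp add: scaleR_conv_of_real[symmetric] of_real_def inner_add_left inner_add_right
          inner_commute[of u 1] power2_eq_square)
    then show ?thesis by (simp add: norm_eq_sqrt_inner)
  qed
  ultimately show ?thesis using uu by blast
qed blast

text \<open>
  A real or complex Banach space is a type of class \<^class>\<open>banach\<close> together with a scalar
  multiplication of the following kind.
\<close>

locale normed_vector_space = vector_space scl
  for scl :: "'k::real_or_complex \<Rightarrow> 'a::real_normed_vector \<Rightarrow> 'a" +
  assumes norm_scale: "norm (scl c x) = norm c * norm x"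
    and scale_of_real: "scl (of_real r) x = r *\<^sub>R x"

lemma normed_vector_space_scaleR:
  "normed_vector_space (scaleR :: real \<Rightarrow> 'a::real_normed_vector \<Rightarrow> 'a)"
  by unfold_locales (simp_all add: scaleR_add_right scaleR_add_left)

text \<open>
  Spaces such as \<open>\<ell>\<^sup>p(X)\<close> are subspaces of a type, with their own norm; hence normed spaces are
  handled as records. Addition and zero are those of the type (pointwise on function types).
\<close>

record ('k, 'v) nspace =
  carr :: "'v set"
  smul :: "'k \<Rightarrow> 'v \<Rightarrow> 'v"
  nrm :: "'v \<Rightarrow> real"

definition space_of ::
    "('k::real_or_complex \<Rightarrow> 'a::real_normed_vector \<Rightarrow> 'a) \<Rightarrow> ('k, 'a) nspace" where
  "space_of scl = \<lparr>carr = UNIV, smul = scl, nrm = norm\<rparr>"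

definition unit_sphere :: "('k, 'v) nspace \<Rightarrow> 'v set" where
  "unit_sphere E = {x \<in> carr E. nrm E x = 1}"

definition normalized :: "('k::real_or_complex, 'v) nspace \<Rightarrow> 'v \<Rightarrow> 'v" where
  "normalized E x = smul E (of_real (inverse (nrm E x))) x"

text \<open>
  The value 0 outside the carrier makes a functional on \<open>E\<close> determined by its restriction to the
  carrier, and makes the dual a linear subspace of the function type.
\<close>

definition dual ::
    "('k::real_or_complex, 'v::ab_group_add) nspace \<Rightarrow> ('k, 'v \<Rightarrow> 'k) nspace" where
  "dual E =
    \<lparr>carr = {f. (\<forall>x\<in>carr E. \<forall>y\<in>carr E. f (x + y) = f x + f y) \<and>
                (\<forall>c. \<forall>x\<in>carr E. f (smul E c x) = c * f x) \<and>
                (\<exists>B. \<forall>x\<in>carr E. norm (f x) \<le> B * nrm E x) \<and>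
                (\<forall>x. x \<notin> carr E \<longrightarrow> f x = 0)},
     smul = (\<lambda>c f x. c * f x),
     nrm = (\<lambda>f. SUP x\<in>{x \<in> carr E. nrm E x \<le> 1}. norm (f x))\<rparr>"

definition weak_topology ::
    "('k::real_or_complex, 'v::ab_group_add) nspace \<Rightarrow> 'v topology" where
  "weak_topology E =
    topology_generated_by {{x \<in> carr E. f x \<in> U} | f U. f \<in> carr (dual E) \<and> open U}"

definition weak_star_topology ::
    "('k::real_or_complex, 'v::ab_group_add) nspace \<Rightarrow> ('v \<Rightarrow> 'k) topology" where
  "weak_star_topology E =
    topology_generated_by {{f \<in> carr (dual E). f x \<in> U} | x U. x \<in> carr E \<and> open U}"

definition state_space ::
    "('k::real_or_complex, 'v::ab_group_add) nspace \<Rightarrow> 'v \<Rightarrow> ('v \<Rightarrow> 'k) set" where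
  "state_space E x = {f \<in> unit_sphere (dual E). f x = 1}"

text \<open>
  \<open>K\<close> is a set of functionals on \<open>E\<close>; the weak topology is the one of the Banach space
  \<open>dual E\<close>, that is, induced by the bidual of \<open>E\<close>.
\<close>

definition id_weak_star_weak_continuous_at ::
    "('k::real_or_complex, 'v::ab_group_add) nspace \<Rightarrow> ('v \<Rightarrow> 'k) set \<Rightarrow> ('v \<Rightarrow> 'k) \<Rightarrow> bool" where
  "id_weak_star_weak_continuous_at E K f \<longleftrightarrow>
    topcontinuous_at (subtopology (weak_star_topology E) K)
      (subtopology (weak_topology (dual E)) K) (\<lambda>g. g) f"

definition weak_star_weak_PC ::
    "('k::real_or_complex, 'v::ab_group_add) nspace \<Rightarrow> ('v \<Rightarrow> 'k) set \<Rightarrow> ('v \<Rightarrow> 'k) \<Rightarrow> bool" where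
  "weak_star_weak_PC E K f \<longleftrightarrow> f \<in> K \<and> id_weak_star_weak_continuous_at E K f"

definition lp_space :: "real \<Rightarrow> ('k, 'v) nspace \<Rightarrow> ('k, nat \<Rightarrow> 'v) nspace" where
  "lp_space p E =
    \<lparr>carr = {x. (\<forall>i. x i \<in> carr E) \<and> summable (\<lambda>i. nrm E (x i) powr p)},
     smul = (\<lambda>c x i. smul E c (x i)),
     nrm = (\<lambda>x. (\<Sum>i. nrm E (x i) powr p) powr (1 / p))\<rparr>"

text \<open>The identification of \<open>\<ell>\<^sup>q(E\<^sup>*)\<close> with the dual of \<open>\<ell>\<^sup>p(E)\<close>.\<close>

definition lp_functional ::
    "real \<Rightarrow> ('k::real_or_complex, 'v) nspace \<Rightarrow> (nat \<Rightarrow> 'v \<Rightarrow> 'k) \<Rightarrow> (nat \<Rightarrow> 'v) \<Rightarrow> 'k" where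
  "lp_functional p E fs =
    (\<lambda>x. if x \<in> carr (lp_space p E) then \<Sum>i. fs i (x i) else 0)"

lemma topspace_weak_topology: "topspace (weak_topology E) = carr E"
proof -
  have "(\<lambda>_. 0) \<in> carr (dual E)"
    by (auto simp: dual_def intro: exI[of _ 0])
  then show ?thesis
    unfolding weak_topology_def topology_generated_by_topspace by (auto intro: open_UNIV)
qed

lemma topspace_weak_star_topology:
  "carr E \<noteq> {} \<Longrightarrow> topspace (weak_star_topology E) = carr (dual E)"
  unfolding weak_star_topology_def topology_generated_by_topspace by (auto intro: open_UNIV)

end

theory Submission
  imports Defs
begin

text \<open>
  Write \<open>Y = \<ell>\<^sup>p(X)\<close>, let \<open>S\<close> be the state space of \<open>x\<close> in \<open>Y\<close> and \<open>S i\<close> the one of the direction of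
  \<open>x i\<close> in \<open>X\<close>. The proof rests on the rigidity of \<open>S\<close>: for every \<open>G\<close> in \<open>S\<close> and every set \<open>A\<close> of
  indices, the value of \<open>G\<close> at the restriction of \<open>x\<close> to \<open>A\<close> is the sum \<open>c\<close> of \<open>norm (x i) powr p\<close> over
  \<open>A\<close>, and the norm of \<open>G\<close> on sequences supported in \<open>A\<close> is at most \<open>c powr (1 - 1 / p)\<close>
  (\<open>state_restr\<close>, \<open>norm_state_restr_le\<close>). This is the equality case of Hoelder's inequality, but
  it is obtained directly from \<open>G x = 1\<close> and \<open>norm (G z) \<le> nrm Y z\<close>, by differentiating the norm of
  \<open>Y\<close> at \<open>x\<close> and by testing \<open>G\<close> on modifications of \<open>x\<close>.

  For a singleton \<open>A\<close>, rigidity says that all \<open>G\<close> in \<open>S\<close> have \<open>i\<close>-th components of the same norm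
  \<open>norm (x i) powr (p - 1)\<close> and that dividing by it leads into \<open>S i\<close>. So normalizing components is
  the restriction to \<open>S\<close> of a bounded linear map \<open>slice i\<close> between the duals, an adjoint. Conversely,
  exchanging the \<open>i\<close>-th component of a state for a multiple of an arbitrary element of \<open>S i\<close> gives a
  state again (\<open>replace_slice_state\<close>), and this is a weak-star continuous section of \<open>slice i\<close>.
  Therefore continuity at a state implies continuity at each of its slices
  (\<open>slice_continuous_at_if\<close>).

  For the converse, rigidity for the tails \<open>{n..}\<close> shows that the tails of all states tend to 0 in
  norm, uniformly over \<open>S\<close> (\<open>tails_uniformly_small\<close>). So on \<open>S\<close> every element of the bidual of
  \<open>Y\<close> is a uniform limit of sums of finitely many elements of the bidual of \<open>X\<close> applied to slices,
  and continuity at the slices suffices (\<open>continuous_at_if_slices\<close>).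
\<close>

section \<open>Normed spaces and their duals\<close>

text \<open>
  What it takes for functionals to have a finite norm that bounds them pointwise: a carrier closed
  under the linear operations and a homogeneous norm. Both \<open>\<ell>\<^sup>p(X)\<close> and every dual are of this kind,
  so that the notion can be iterated up to the bidual.
\<close>

locale homogeneous_nspace =
  fixes E :: "('k::real_or_complex, 'v::ab_group_add) nspace"
  assumes zero_carr: "0 \<in> carr E"
    and add_carr: "\<And>x y. x \<in> carr E \<Longrightarrow> y \<in> carr E \<Longrightarrow> x + y \<in> carr E"
    and smul_carr: "\<And>c x. x \<in> carr E \<Longrightarrow> smul E c x \<in> carr E"
    and nrm_nonneg: "\<And>x. x \<in> carr E \<Longrightarrow> 0 \<le> nrm E x"
    and nrm_smul: "\<And>c x. x \<in> carr E \<Longrightarrow> nrm E (smul E c x) = norm c * nrm E x"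

lemma dual_add: "f \<in> carr (dual E) \<Longrightarrow> x \<in> carr E \<Longrightarrow> y \<in> carr E \<Longrightarrow> f (x + y) = f x + f y"
  and dual_smul: "f \<in> carr (dual E) \<Longrightarrow> x \<in> carr E \<Longrightarrow> f (smul E c x) = c * f x"
  and dual_outside: "f \<in> carr (dual E) \<Longrightarrow> x \<notin> carr E \<Longrightarrow> f x = 0"
  and dual_bounded: "f \<in> carr (dual E) \<Longrightarrow> \<exists>B. \<forall>x\<in>carr E. norm (f x) \<le> B * nrm E x"
  by (auto simp: dual_def)

lemma dual_memI:
  assumes "\<And>x y. x \<in> carr E \<Longrightarrow> y \<in> carr E \<Longrightarrow> f (x + y) = f x + f y"
    and "\<And>c x. x \<in> carr E \<Longrightarrow> f (smul E c x) = c * f x"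
    and "\<And>x. x \<in> carr E \<Longrightarrow> norm (f x) \<le> B * nrm E x"
    and "\<And>x. x \<notin> carr E \<Longrightarrow> f x = 0"
  shows "f \<in> carr (dual E)"
  unfolding dual_def using assms by simp blast

lemma smul_dual: "smul (dual E) c f = (\<lambda>x. c * f x)"
  by (simp add: dual_def)

context homogeneous_nspace
begin

lemma nrm_zero: "nrm E (smul E 0 0) = 0"
  using nrm_smul[OF zero_carr, of 0] by simp

lemma bdd_above_dual:
  assumes f: "f \<in> carr (dual E)"
  shows "bdd_above ((\<lambda>x. norm (f x)) ` {x \<in> carr E. nrm E x \<le> 1})"
proof -
  from dual_bounded[OF f] obtain B where B: "\<And>x. x \<in> carr E \<Longrightarrow> norm (f x) \<le> B * nrm E x"
    by blast
  show ?thesis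
  proof (rule bdd_aboveI2)
    fix x assume "x \<in> {x \<in> carr E. nrm E x \<le> 1}"
    then have x: "x \<in> carr E" "nrm E x \<le> 1" by auto
    have "norm (f x) \<le> B * nrm E x" by (rule B[OF x(1)])
    also have "\<dots> \<le> \<bar>B\<bar> * nrm E x" using nrm_nonneg[OF x(1)] by (simp add: mult_right_mono)
    also have "\<dots> \<le> \<bar>B\<bar> * 1" using x(2) by (intro mult_left_mono) auto
    finally show "norm (f x) \<le> \<bar>B\<bar>" by simp
  qed
qed

lemma nrm_dual_nonneg:
  assumes "f \<in> carr (dual E)" shows "0 \<le> nrm (dual E) f"
proof -
  have "norm (f (smul E 0 0)) \<le> nrm (dual E) f"
    using nrm_zero smul_carr[OF zero_carr, of 0] bdd_above_dual[OF assms]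
    by (auto simp: dual_def intro!: cSUP_upper)
  then show ?thesis using norm_ge_zero order_trans by blast
qed

lemma dual_le_nrm:
  assumes f: "f \<in> carr (dual E)" and z: "z \<in> carr E"
  shows "norm (f z) \<le> nrm (dual E) f * nrm E z"
proof (cases "nrm E z = 0")
  case True
  then show ?thesis using dual_bounded[OF f] z by force
next
  case False
  then have pos: "nrm E z > 0" using nrm_nonneg[OF z] by simp
  let ?u = "smul E (of_real (inverse (nrm E z))) z"
  have u: "?u \<in> carr E" "nrm E ?u = 1"
    using pos by (simp_all add: smul_carr z nrm_smul del: of_real_inverse)
  then have "norm (f ?u) \<le> nrm (dual E) f"
    using bdd_above_dual[OF f] by (auto simp: dual_def intro!: cSUP_upper)
  from mult_right_mono[OF this, of "nrm E z"] pos
  have "norm (f ?u) * nrm E z \<le> nrm (dual E) f * nrm E z"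
    by simp
  moreover have "norm (f ?u) * nrm E z = norm (f z)"
    using pos by (simp add: dual_smul[OF f z] norm_mult norm_inverse norm_divide)
  ultimately show ?thesis by simp
qed

lemma nrm_dual_le:
  assumes "0 \<le> c" and "\<And>z. z \<in> carr E \<Longrightarrow> norm (f z) \<le> c * nrm E z"
  shows "nrm (dual E) f \<le> c"
proof -
  have "{x \<in> carr E. nrm E x \<le> 1} \<noteq> {}"
    using nrm_zero smul_carr[OF zero_carr, of 0] by force
  moreover have "norm (f z) \<le> c" if "z \<in> carr E" "nrm E z \<le> 1" for z
    using assms(2)[OF that(1)] mult_left_mono[OF that(2) assms(1)] by simp
  ultimately have "(SUP x\<in>{x \<in> carr E. nrm E x \<le> 1}. norm (f x)) \<le> c"
    by (intro cSUP_least) auto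
  then show ?thesis by (simp add: dual_def)
qed

lemma nrm_dual_eqI:
  assumes f: "f \<in> carr (dual E)" and bound: "\<And>z. z \<in> carr E \<Longrightarrow> norm (f z) \<le> c * nrm E z"
    and u: "u \<in> carr E" "nrm E u = 1" "norm (f u) = c"
  shows "nrm (dual E) f = c"
proof (rule antisym)
  show "nrm (dual E) f \<le> c"
    using u(3) by (intro nrm_dual_le bound) auto
  show "c \<le> nrm (dual E) f"
    using dual_le_nrm[OF f u(1)] u by simp
qed

text \<open>
  Attaining the bound 1 at a unit vector fixes the norm, so membership in a state space is a
  pointwise condition and no supremum has to be computed.
\<close>

lemma state_space_iff:
  assumes "x \<in> carr E" "nrm E x = 1"
  shows "f \<in> state_space E x \<longleftrightarrow>
    f \<in> carr (dual E) \<and> (\<forall>z\<in>carr E. norm (f z) \<le> nrm E z) \<and> f x = 1"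
proof
  assume "f \<in> state_space E x"
  then show "f \<in> carr (dual E) \<and> (\<forall>z\<in>carr E. norm (f z) \<le> nrm E z) \<and> f x = 1"
    using dual_le_nrm by (force simp: state_space_def unit_sphere_def)
next
  assume "f \<in> carr (dual E) \<and> (\<forall>z\<in>carr E. norm (f z) \<le> nrm E z) \<and> f x = 1"
  moreover from this have "nrm (dual E) f = 1"
    using assms by (intro nrm_dual_eqI) auto
  ultimately show "f \<in> state_space E x"
    by (simp add: state_space_def unit_sphere_def)
qed

lemma homogeneous_nspace_dual: "homogeneous_nspace (dual E)"
proof
  show "0 \<in> carr (dual E)"
    by (rule dual_memI[where B = 0]) auto
next
  fix f g assume fg: "f \<in> carr (dual E)" "g \<in> carr (dual E)"
  show "f + g \<in> carr (dual E)"
  proof (rule dual_memI[where B = "nrm (dual E) f + nrm (dual E) g"])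
    fix z assume z: "z \<in> carr E"
    have "norm ((f + g) z) \<le> norm (f z) + norm (g z)"
      by (simp add: norm_triangle_ineq)
    also have "\<dots> \<le> (nrm (dual E) f + nrm (dual E) g) * nrm E z"
      using dual_le_nrm[OF fg(1) z] dual_le_nrm[OF fg(2) z] by (simp add: algebra_simps)
    finally show "norm ((f + g) z) \<le> (nrm (dual E) f + nrm (dual E) g) * nrm E z" .
  qed (use fg in \<open>auto simp: dual_add dual_smul dual_outside algebra_simps\<close>)
next
  fix c f assume f: "f \<in> carr (dual E)"
  show smul: "smul (dual E) c f \<in> carr (dual E)" for c
  proof (rule dual_memI[where B = "norm c * nrm (dual E) f"])
    fix z assume "z \<in> carr E"
    from mult_left_mono[OF dual_le_nrm[OF f this], of "norm c"]
    show "norm (smul (dual E) c f z) \<le> norm c * nrm (dual E) f * nrm E z"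
      by (simp add: smul_dual norm_mult mult.assoc)
  qed (use f in \<open>auto simp: smul_dual dual_add dual_smul dual_outside algebra_simps\<close>)
  have le: "nrm (dual E) (smul (dual E) c g) \<le> norm c * nrm (dual E) g"
    if g: "g \<in> carr (dual E)" for c g
  proof (rule nrm_dual_le)
    fix z assume "z \<in> carr E"
    from mult_left_mono[OF dual_le_nrm[OF g this], of "norm c"]
    show "norm (smul (dual E) c g z) \<le> norm c * nrm (dual E) g * nrm E z"
      by (simp add: smul_dual norm_mult mult.assoc)
  qed (simp add: nrm_dual_nonneg g)
  show "nrm (dual E) (smul (dual E) c f) = norm c * nrm (dual E) f"
  proof (cases "c = 0")
    case True
    then show ?thesis using le[OF f, of c] nrm_dual_nonneg[OF smul[of c]] by simp
  next
    case False
    then have "smul (dual E) (inverse c) (smul (dual E) c f) = f"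
      by (simp add: smul_dual mult.assoc[symmetric])
    with le[OF smul, of "inverse c" c] False
    have "norm c * nrm (dual E) f \<le> nrm (dual E) (smul (dual E) c f)"
      by (simp add: norm_inverse norm_divide field_simps)
    with le[OF f, of c] show ?thesis by simp
  qed
qed (rule nrm_dual_nonneg)

end

section \<open>Adjoints and points of weak-star to weak continuity\<close>

definition bounded_operator ::
    "('k::real_or_complex, 'v::ab_group_add) nspace \<Rightarrow> ('k, 'w::ab_group_add) nspace \<Rightarrow>
      ('v \<Rightarrow> 'w) \<Rightarrow> bool" where
  "bounded_operator E F L \<longleftrightarrow>
    (\<forall>z\<in>carr E. L z \<in> carr F) \<and>
    (\<forall>y\<in>carr E. \<forall>z\<in>carr E. L (y + z) = L y + L z) \<and>
    (\<forall>c. \<forall>z\<in>carr E. L (smul E c z) = smul F c (L z)) \<and>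
    (\<exists>B\<ge>0. \<forall>z\<in>carr E. nrm F (L z) \<le> B * nrm E z)"

text \<open>
  The value 0 outside the carrier is the one that elements of a dual are required to have.
\<close>

definition adjoint_on ::
    "('k::real_or_complex, 'v) nspace \<Rightarrow> ('v \<Rightarrow> 'w) \<Rightarrow> ('w \<Rightarrow> 'k) \<Rightarrow> 'v \<Rightarrow> 'k" where
  "adjoint_on E L g = (\<lambda>z. if z \<in> carr E then g (L z) else 0)"

lemma adjoint_on_apply: "z \<in> carr E \<Longrightarrow> adjoint_on E L g z = g (L z)"
  by (simp add: adjoint_on_def)

context
  fixes E :: "('k::real_or_complex, 'v::ab_group_add) nspace"
    and F :: "('k, 'w::ab_group_add) nspace" and L
  assumes E: "homogeneous_nspace E" and F: "homogeneous_nspace F" and L: "bounded_operator E F L"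
begin

interpretation E: homogeneous_nspace E by (rule E)
interpretation F: homogeneous_nspace F by (rule F)

lemma adjoint_on_dual:
  assumes g: "g \<in> carr (dual F)"
  shows "adjoint_on E L g \<in> carr (dual E)"
proof -
  from L obtain B where B: "\<And>z. z \<in> carr E \<Longrightarrow> nrm F (L z) \<le> B * nrm E z"
    unfolding bounded_operator_def by blast
  show ?thesis
  proof (rule dual_memI[where B = "nrm (dual F) g * B"])
    fix z assume z: "z \<in> carr E"
    then have "L z \<in> carr F" using L by (auto simp: bounded_operator_def)
    from F.dual_le_nrm[OF g this] mult_left_mono[OF B[OF z] F.nrm_dual_nonneg[OF g]]
    show "norm (adjoint_on E L g z) \<le> nrm (dual F) g * B * nrm E z"
      by (simp add: adjoint_on_apply z mult.assoc)
  qed (use L g in \<open>auto simp: adjoint_on_def bounded_operator_def E.add_carr E.smul_carr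
        dual_add dual_smul\<close>)
qed

lemma bounded_operator_adjoint_on: "bounded_operator (dual F) (dual E) (adjoint_on E L)"
proof -
  from L obtain B where B: "B \<ge> 0" "\<And>z. z \<in> carr E \<Longrightarrow> nrm F (L z) \<le> B * nrm E z"
    by (auto simp: bounded_operator_def)
  have "nrm (dual E) (adjoint_on E L g) \<le> B * nrm (dual F) g" if g: "g \<in> carr (dual F)" for g
  proof (rule E.nrm_dual_le)
    show "0 \<le> B * nrm (dual F) g" using B F.nrm_dual_nonneg[OF g] by simp
    fix z assume z: "z \<in> carr E"
    then have "L z \<in> carr F" using L by (auto simp: bounded_operator_def)
    from F.dual_le_nrm[OF g this] mult_left_mono[OF B(2)[OF z] F.nrm_dual_nonneg[OF g]]
    show "norm (adjoint_on E L g z) \<le> B * nrm (dual F) g * nrm E z"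
      by (simp add: adjoint_on_apply z ac_simps)
  qed
  with B(1) show ?thesis
    unfolding bounded_operator_def
    by (intro conjI ballI allI exI[of _ B] adjoint_on_dual)
      (auto simp: smul_dual adjoint_on_def fun_eq_iff)
qed

end

text \<open>
  Weak-star open sets are generated by conditions on single values, so a map of duals is weak-star
  continuous as soon as each value of the image is a translate of one value of the argument.
\<close>

lemma weak_star_continuous_map:
  fixes E :: "('k::real_or_complex, 'v::ab_group_add) nspace"
    and F :: "('k, 'w::ab_group_add) nspace"
  assumes ne: "carr E \<noteq> {}" "carr F \<noteq> {}"
    and T: "\<And>g. g \<in> carr (dual F) \<Longrightarrow> T g \<in> carr (dual E)"
    and ev: "\<And>z. z \<in> carr E \<Longrightarrow> \<exists>a. \<exists>y\<in>carr F. \<forall>g\<in>carr (dual F). T g z = a + g y"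
  shows "continuous_map (weak_star_topology F) (weak_star_topology E) T"
  unfolding weak_star_topology_def[of E]
proof (rule continuous_on_generated_topo)
  fix W assume "W \<in> {{f \<in> carr (dual E). f z \<in> U} | z U. z \<in> carr E \<and> open U}"
  then obtain z U where W: "W = {f \<in> carr (dual E). f z \<in> U}" "z \<in> carr E" "open U"
    by auto
  from ev[OF W(2)] obtain a y
    where ay: "y \<in> carr F" "\<And>g. g \<in> carr (dual F) \<Longrightarrow> T g z = a + g y" by auto
  have "open ((\<lambda>c. a + c) -` U)"
    by (intro open_vimage W(3) continuous_intros)
  then have "openin (weak_star_topology F) {g \<in> carr (dual F). g y \<in> (\<lambda>c. a + c) -` U}"
    unfolding weak_star_topology_def using ay(1)
    by (intro topology_generated_by_Basis) blast
  moreover have "T -` W \<inter> topspace (weak_star_topology F) =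
      {g \<in> carr (dual F). g y \<in> (\<lambda>c. a + c) -` U}"
    using T ay(2) by (auto simp: W(1) topspace_weak_star_topology[OF ne(2)])
  ultimately show "openin (weak_star_topology F) (T -` W \<inter> topspace (weak_star_topology F))"
    by simp
next
  have "T ` carr (dual F) \<subseteq> topspace (weak_star_topology E)"
    using T by (auto simp: topspace_weak_star_topology[OF ne(1)])
  then show "T ` topspace (weak_star_topology F) \<subseteq>
      \<Union> {{f \<in> carr (dual E). f z \<in> U} | z U. z \<in> carr E \<and> open U}"
    unfolding topspace_weak_star_topology[OF ne(2)]
    unfolding weak_star_topology_def topology_generated_by_topspace .
qed

text \<open>
  It suffices to test continuity at a point on a subbasis of the target, and the weak topology has the
  conditions on single bidual elements as a subbasis.
\<close>

lemma id_continuous_at_iff: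
  fixes E :: "('k::real_or_complex, 'v::ab_group_add) nspace"
  assumes ne: "carr E \<noteq> {}" and K: "K \<subseteq> carr (dual E)" and f: "f \<in> K"
  shows "id_weak_star_weak_continuous_at E K f \<longleftrightarrow>
    (\<forall>\<Phi>\<in>carr (dual (dual E)). \<forall>e>0. \<exists>U. openin (weak_star_topology E) U \<and> f \<in> U \<and>
      (\<forall>g\<in>U \<inter> K. norm (\<Phi> g - \<Phi> f) < e))"
    (is "?l \<longleftrightarrow> ?r")
proof
  assume l: ?l
  show ?r
  proof (intro ballI allI impI)
    fix \<Phi> and e :: real assume \<Phi>: "\<Phi> \<in> carr (dual (dual E))" and e: "e > 0"
    let ?V = "{g \<in> carr (dual E). \<Phi> g \<in> ball (\<Phi> f) e}"
    have "openin (weak_topology (dual E)) ?V"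
      unfolding weak_topology_def using \<Phi> open_ball
      by (intro topology_generated_by_Basis) blast
    then have "openin (subtopology (weak_topology (dual E)) K) (?V \<inter> K)"
      by (auto simp: openin_subtopology)
    moreover have "f \<in> ?V \<inter> K"
      using subsetD[OF K f] f e by (intro IntI CollectI conjI) simp_all
    ultimately have "\<exists>U. openin (subtopology (weak_star_topology E) K) U \<and> f \<in> U \<and>
        (\<forall>g\<in>U. g \<in> ?V \<inter> K)"
      by (intro l[unfolded id_weak_star_weak_continuous_at_def topcontinuous_at_def,
            THEN conjunct2, THEN conjunct2, rule_format] conjI)
    then obtain U where U: "openin (subtopology (weak_star_topology E) K) U" "f \<in> U"
        "U \<subseteq> ?V \<inter> K"
      by (elim exE conjE) (simp only: subset_eq)
    from U(1) obtain W where W: "openin (weak_star_topology E) W" "U = W \<inter> K"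
      by (auto simp: openin_subtopology)
    then show "\<exists>U. openin (weak_star_topology E) U \<and> f \<in> U \<and>
        (\<forall>g\<in>U \<inter> K. norm (\<Phi> g - \<Phi> f) < e)"
      using U(2,3) by (intro exI[of _ W]) (auto simp: dist_norm norm_minus_commute)
  qed
next
  assume r: ?r
  have main: "\<exists>U. openin (weak_star_topology E) U \<and> f \<in> U \<and> U \<inter> K \<subseteq> W"
    if "generate_topology_on {{g \<in> carr (dual E). \<Phi> g \<in> V} | \<Phi> V.
          \<Phi> \<in> carr (dual (dual E)) \<and> open V} W" "f \<in> W" for W
    using that
  proof induction
    case Empty
    then show ?case by simp
  next
    case (Int A B)
    then obtain U1 U2 where "openin (weak_star_topology E) U1 \<and> f \<in> U1 \<and> U1 \<inter> K \<subseteq> A"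
        "openin (weak_star_topology E) U2 \<and> f \<in> U2 \<and> U2 \<inter> K \<subseteq> B"
      by auto
    then show ?case by (intro exI[of _ "U1 \<inter> U2"]) auto
  next
    case (UN \<A>)
    then obtain A where A: "A \<in> \<A>" "f \<in> A" by auto
    from UN.IH[OF this] obtain U where "openin (weak_star_topology E) U" "f \<in> U" "U \<inter> K \<subseteq> A"
      by (elim exE conjE)
    with A(1) show ?case by (intro exI[of _ U]) auto
  next
    case (Basis W)
    then obtain \<Phi> V where W: "W = {g \<in> carr (dual E). \<Phi> g \<in> V}"
        "\<Phi> \<in> carr (dual (dual E))" "open V" by auto
    with Basis obtain e where e: "e > 0" "ball (\<Phi> f) e \<subseteq> V"
      by (auto simp: open_contains_ball)
    from r W(2) e(1) have "\<exists>U. openin (weak_star_topology E) U \<and> f \<in> U \<and>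
        (\<forall>g\<in>U \<inter> K. norm (\<Phi> g - \<Phi> f) < e)"
      by simp
    then obtain U where U: "openin (weak_star_topology E) U" "f \<in> U"
        "\<And>g. g \<in> U \<inter> K \<Longrightarrow> norm (\<Phi> g - \<Phi> f) < e"
      by (elim exE conjE) simp
    have "\<Phi> g \<in> V" if "g \<in> U \<inter> K" for g
      using U(3)[OF that] e(2) by (intro subsetD[OF e(2)]) (simp add: dist_norm norm_minus_commute)
    then have "U \<inter> K \<subseteq> W" using K unfolding W(1) by (intro subsetI CollectI conjI) auto
    with U(1,2) show ?case by (intro exI[of _ U]) simp
  qed
  show ?l
    unfolding id_weak_star_weak_continuous_at_def topcontinuous_at_def
  proof (intro conjI allI impI)
    show "f \<in> topspace (subtopology (weak_star_topology E) K)"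
      using f K by (auto simp: topspace_weak_star_topology[OF ne])
    show "(\<lambda>g. g) \<in> topspace (subtopology (weak_star_topology E) K) \<rightarrow>
        topspace (subtopology (weak_topology (dual E)) K)"
      by (auto simp: topspace_weak_star_topology[OF ne] topspace_weak_topology)
    fix V assume "openin (subtopology (weak_topology (dual E)) K) V \<and> f \<in> V"
    then obtain W where W: "openin (weak_topology (dual E)) W" "V = W \<inter> K" "f \<in> W"
      by (auto simp: openin_subtopology)
    then have "generate_topology_on {{g \<in> carr (dual E). \<Phi> g \<in> V} | \<Phi> V.
          \<Phi> \<in> carr (dual (dual E)) \<and> open V} W"
      by (simp add: weak_topology_def openin_topology_generated_by_iff)
    from main[OF this W(3)] obtain U
      where U: "openin (weak_star_topology E) U" "f \<in> U" "U \<inter> K \<subseteq> W"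
      by (elim exE conjE)
    from U(1) have "openin (subtopology (weak_star_topology E) K) (U \<inter> K)"
      by (rule openin_subtopology_Int)
    with U(2,3) W(2) f
    show "\<exists>U. openin (subtopology (weak_star_topology E) K) U \<and> f \<in> U \<and> (\<forall>y\<in>U. y \<in> V)"
      by (intro exI[of _ "U \<inter> K"]) auto
  qed
qed

text \<open>
  The map \<open>R\<close> embeds \<open>K'\<close> into \<open>K\<close> with the bounded linear left inverse \<open>T\<close>: composing a bidual
  element with \<open>T\<close> moves the weak condition from \<open>F\<close> to \<open>E\<close>, where the hypothesis provides a weak-star
  neighbourhood, and \<open>R\<close> pulls this neighbourhood back. The section \<open>R\<close> is an arbitrary continuous map
  because the one that replaces a component of a functional is affine.
\<close>

lemma id_continuous_at_transfer:
  fixes E :: "('k::real_or_complex, 'v::ab_group_add) nspace"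
    and F :: "('k, 'w::ab_group_add) nspace"
  assumes hom: "homogeneous_nspace E" "homogeneous_nspace F"
    and K: "K \<subseteq> carr (dual E)" and K': "K' \<subseteq> carr (dual F)" and f: "f \<in> K'"
    and R: "continuous_map (weak_star_topology F) (weak_star_topology E) R" "R ` K' \<subseteq> K"
    and T: "bounded_operator (dual E) (dual F) T" "\<And>g. g \<in> K' \<Longrightarrow> T (R g) = g"
    and cont: "id_weak_star_weak_continuous_at E K (R f)"
  shows "id_weak_star_weak_continuous_at F K' f"
proof -
  have ne: "carr E \<noteq> {}" "carr F \<noteq> {}"
    using hom[THEN homogeneous_nspace.zero_carr] by auto
  have Rf: "R f \<in> K" using R(2) f by auto
  show ?thesis
    unfolding id_continuous_at_iff[OF ne(2) K' f]
  proof (intro ballI allI impI)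
    fix \<Psi> and e :: real assume \<Psi>: "\<Psi> \<in> carr (dual (dual F))" and e: "e > 0"
    have "adjoint_on (dual E) T \<Psi> \<in> carr (dual (dual E))"
      by (rule adjoint_on_dual[OF hom[THEN homogeneous_nspace.homogeneous_nspace_dual] T(1) \<Psi>])
    then have "\<exists>U. openin (weak_star_topology E) U \<and> R f \<in> U \<and> (\<forall>g\<in>U \<inter> K.
         norm (adjoint_on (dual E) T \<Psi> g - adjoint_on (dual E) T \<Psi> (R f)) < e)"
      using cont e unfolding id_continuous_at_iff[OF ne(1) K Rf] by simp
    then obtain U where U: "openin (weak_star_topology E) U" "R f \<in> U"
      "\<And>g. g \<in> U \<Longrightarrow> g \<in> K \<Longrightarrow>
         norm (adjoint_on (dual E) T \<Psi> g - adjoint_on (dual E) T \<Psi> (R f)) < e"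
      by (elim exE conjE) simp
    let ?U = "{g \<in> topspace (weak_star_topology F). R g \<in> U}"
    have "openin (weak_star_topology F) ?U"
      using R(1) U(1) by (rule openin_continuous_map_preimage)
    moreover have "f \<in> ?U"
      using U(2) f K' by (auto simp: topspace_weak_star_topology[OF ne(2)])
    moreover have "norm (\<Psi> g - \<Psi> f) < e" if "g \<in> ?U \<inter> K'" for g
    proof -
      have "R g \<in> K" "R g \<in> U" "g \<in> K'" using that R(2) by auto
      then show ?thesis
        using U(3)[of "R g"] K Rf f T(2) by (auto simp: adjoint_on_def subset_iff)
    qed
    ultimately show "\<exists>U. openin (weak_star_topology F) U \<and> f \<in> U \<and>
        (\<forall>g\<in>U \<inter> K'. norm (\<Psi> g - \<Psi> f) < e)"
      by (intro exI[of _ ?U] conjI ballI)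
  qed
qed

section \<open>Sequence spaces\<close>

lemma exists_unit_rotation:
  fixes a :: "'k::real_or_complex"
  obtains \<theta> where "norm \<theta> = 1" "\<theta> * a = of_real (norm a)"
proof (cases "a = 0")
  case True
  with that[of 1] show ?thesis by simp
next
  case False
  with that[of "of_real (norm a) / a"] show ?thesis by (simp add: norm_divide)
qed

lemma inner_one_one: "inner 1 (1 :: 'k::real_or_complex) = 1"
  by (simp add: dot_square_norm)

lemma inner_one_le_norm: "inner 1 (a :: 'k::real_or_complex) \<le> norm a"
  using norm_cauchy_schwarz[of 1 a] by simp

definition restr :: "nat set \<Rightarrow> (nat \<Rightarrow> 'v::zero) \<Rightarrow> nat \<Rightarrow> 'v" where
  "restr A z = (\<lambda>i. if i \<in> A then z i else 0)"

definition emb :: "nat \<Rightarrow> 'v::zero \<Rightarrow> nat \<Rightarrow> 'v" where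
  "emb i y = (\<lambda>j. if j = i then y else 0)"

lemma restr_singleton: "restr {i} z = emb i (z i)"
  by (auto simp: restr_def emb_def)

locale lp_sequences = normed_vector_space scl
  for scl :: "'k::real_or_complex \<Rightarrow> 'a::real_normed_vector \<Rightarrow> 'a" +
  fixes p :: real
  assumes p_gt_1: "1 < p"
begin

abbreviation X :: "('k, 'a) nspace" where "X \<equiv> space_of scl"
abbreviation Y :: "('k, nat \<Rightarrow> 'a) nspace" where "Y \<equiv> lp_space p X"

text \<open>
  The \<open>p\<close>-th power of the norm, which, unlike the norm, is additive over sequences with disjoint
  supports.
\<close>

definition npow :: "(nat \<Rightarrow> 'a) \<Rightarrow> real" where
  "npow z = (\<Sum>i. norm (z i) powr p)"

lemma X_simps [simp]: "carr X = UNIV" "smul X = scl" "nrm X = norm"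
  by (simp_all add: space_of_def)

lemma carr_Y: "z \<in> carr Y \<longleftrightarrow> summable (\<lambda>i. norm (z i) powr p)"
  by (simp add: lp_space_def)

lemma smul_Y: "smul Y c z = (\<lambda>i. scl c (z i))"
  by (simp add: lp_space_def)

lemma nrm_Y: "nrm Y z = npow z powr (1 / p)"
  by (simp add: lp_space_def npow_def)

lemma npow_nonneg: "z \<in> carr Y \<Longrightarrow> 0 \<le> npow z"
  by (simp add: npow_def carr_Y suminf_nonneg)

lemma nrm_Y_powr: "z \<in> carr Y \<Longrightarrow> nrm Y z powr p = npow z"
  using p_gt_1 npow_nonneg by (simp add: nrm_Y powr_powr)

lemma nrm_Y_le: "z \<in> carr Y \<Longrightarrow> y \<in> carr Y \<Longrightarrow> npow z \<le> npow y \<Longrightarrow> nrm Y z \<le> nrm Y y"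
  using p_gt_1 npow_nonneg by (simp add: nrm_Y powr_mono2)

lemma homogeneous_X: "homogeneous_nspace X"
  by unfold_locales (simp_all add: norm_scale)

lemma smul_carr_Y: "z \<in> carr Y \<Longrightarrow> smul Y c z \<in> carr Y"
  by (simp add: carr_Y smul_Y norm_scale powr_mult summable_mult)

lemma npow_smul: "z \<in> carr Y \<Longrightarrow> npow (smul Y c z) = norm c powr p * npow z"
  by (simp add: npow_def carr_Y smul_Y norm_scale powr_mult suminf_mult)

lemma add_carr_Y:
  assumes "y \<in> carr Y" "z \<in> carr Y"
  shows "y + z \<in> carr Y"
  unfolding carr_Y
proof (rule summable_comparison_test')
  show "summable (\<lambda>i. 2 powr p * (norm (y i) powr p + norm (z i) powr p))"
    using assms by (intro summable_mult summable_add) (auto simp: carr_Y)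
  fix i :: nat
  have "norm ((y + z) i) \<le> 2 * max (norm (y i)) (norm (z i))"
    using norm_triangle_ineq[of "y i" "z i"] by simp
  then have "norm ((y + z) i) powr p \<le> (2 * max (norm (y i)) (norm (z i))) powr p"
    using p_gt_1 by (intro powr_mono2) auto
  also have "\<dots> = 2 powr p * max (norm (y i)) (norm (z i)) powr p"
    by (simp add: powr_mult)
  also have "\<dots> \<le> 2 powr p * (norm (y i) powr p + norm (z i) powr p)"
    by (intro mult_left_mono) (auto simp: max_def)
  finally show "norm (norm ((y + z) i) powr p) \<le> 2 powr p * (norm (y i) powr p + norm (z i) powr p)"
    by simp
qed

lemma homogeneous_Y: "homogeneous_nspace Y"
proof
  show "0 \<in> carr Y" by (simp add: carr_Y)
  show "0 \<le> nrm Y z" for z by (simp add: nrm_Y)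
  show "nrm Y (smul Y c z) = norm c * nrm Y z" if "z \<in> carr Y" for c z
    using that p_gt_1 npow_nonneg[OF that]
    by (simp add: nrm_Y npow_smul powr_mult powr_powr)
qed (simp_all add: add_carr_Y smul_carr_Y)

sublocale X: homogeneous_nspace X by (rule homogeneous_X)
sublocale Y: homogeneous_nspace Y by (rule homogeneous_Y)

lemma norm_restr_powr: "norm (restr A z i) powr p = (if i \<in> A then norm (z i) powr p else 0)"
  for z :: "nat \<Rightarrow> 'a"
  by (simp add: restr_def)

lemma restr_carr: "z \<in> carr Y \<Longrightarrow> restr A z \<in> carr Y"
  unfolding carr_Y by (rule summable_comparison_test'[where N = 0]) (auto simp: norm_restr_powr)

lemma smul_restr: "smul Y c (restr A z) = restr A (smul Y c z)"
  by (auto simp: smul_Y restr_def)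

lemma restr_split: "restr A z + restr (- A) z = z" for z :: "nat \<Rightarrow> 'a"
  by (auto simp: restr_def)

lemma npow_restr_add:
  assumes "y \<in> carr Y" "z \<in> carr Y"
  shows "npow (restr A y + restr (- A) z) = npow (restr A y) + npow (restr (- A) z)"
proof -
  have "norm ((restr A y + restr (- A) z) i) powr p =
      norm (restr A y i) powr p + norm (restr (- A) z i) powr p" for i
    by (simp add: restr_def)
  then show ?thesis
    using restr_carr[OF assms(1), of A] restr_carr[OF assms(2), of "- A"]
    by (simp add: npow_def carr_Y suminf_add)
qed

lemma npow_restr_le: "z \<in> carr Y \<Longrightarrow> npow (restr A z) \<le> npow z"
  using npow_restr_add[of z z A] npow_nonneg[OF restr_carr[of z "- A"]]
  by (simp add: restr_split)

lemma bounded_operator_restr: "bounded_operator Y Y (restr A)"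
  unfolding bounded_operator_def
  by (intro conjI ballI allI exI[of _ 1])
    (auto simp: restr_carr smul_restr nrm_Y_le npow_restr_le, auto simp: restr_def)

lemma emb_sums: "(\<lambda>j. norm (emb i y j) powr p) sums (norm y powr p)" for y :: 'a
proof -
  have "(\<lambda>j. norm (emb i y j) powr p) = (\<lambda>j. if j = i then norm y powr p else 0)"
    by (auto simp: emb_def)
  then show ?thesis using sums_single[of i "\<lambda>_. norm y powr p"] by simp
qed

lemma emb_carr: "emb i y \<in> carr Y"
  using emb_sums sums_summable by (auto simp: carr_Y)

lemma npow_emb: "npow (emb i y) = norm y powr p"
  using emb_sums[of i y] by (simp add: npow_def sums_iff)

lemma nrm_emb: "nrm Y (emb i y) = norm y"
  using p_gt_1 by (simp add: nrm_Y npow_emb powr_powr)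

lemma emb_add: "emb i (y + z) = emb i y + emb i z" for y z :: 'a
  by (auto simp: emb_def)

lemma emb_scl: "emb i (scl c y) = smul Y c (emb i y)"
  by (auto simp: emb_def smul_Y)

lemma norm_coord_le: "z \<in> carr Y \<Longrightarrow> norm (z i) \<le> nrm Y z"
  using nrm_Y_le[of "restr {i} z" z] restr_carr[of z "{i}"] npow_restr_le[of z "{i}"]
  by (simp add: restr_singleton nrm_emb)

lemma bounded_operator_emb: "bounded_operator X Y (\<lambda>y. emb i (scl c y))"
  unfolding bounded_operator_def
  by (intro conjI ballI allI exI[of _ "norm c"])
    (auto simp: emb_carr nrm_emb scale_right_distrib emb_add norm_scale scale_left_commute,
      simp add: emb_scl[symmetric] scale_left_commute mult.commute)

lemma bounded_operator_coord: "bounded_operator Y X (\<lambda>z. scl c (z i))"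
  unfolding bounded_operator_def
  by (intro conjI ballI allI exI[of _ "norm c"])
    (auto simp: scale_right_distrib norm_scale norm_coord_le mult_left_mono smul_Y mult.commute)

lemma npow_tail_tendsto_0:
  assumes "z \<in> carr Y"
  shows "(\<lambda>n. npow (restr {n..} z)) \<longlonglongrightarrow> 0"
proof -
  have "npow (restr {n..} z) = npow z - (\<Sum>i<n. norm (z i) powr p)" for n
  proof -
    have "(\<lambda>i. norm (restr (- {n..}) z i) powr p) = (\<lambda>i. if i \<in> {..<n} then norm (z i) powr p else 0)"
      by (auto simp: norm_restr_powr)
    then have "npow (restr (- {n..}) z) = (\<Sum>i<n. norm (z i) powr p)"
      using sums_If_finite_set[of "{..<n}" "\<lambda>i. norm (z i) powr p"]
      by (simp add: npow_def sums_iff)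
    then show ?thesis
      using npow_restr_add[OF assms assms, of "{n..}", unfolded restr_split] by simp
  qed
  moreover have "(\<lambda>n. npow z - (\<Sum>i<n. norm (z i) powr p)) \<longlonglongrightarrow> npow z - npow z"
    using assms unfolding npow_def carr_Y by (intro tendsto_diff tendsto_const summable_LIMSEQ)
  ultimately show ?thesis by simp
qed

end

section \<open>Functionals attaining their norm at a sequence\<close>

locale lp_state = lp_sequences scl p
  for scl :: "'k::real_or_complex \<Rightarrow> 'a::real_normed_vector \<Rightarrow> 'a" and p +
  fixes x :: "nat \<Rightarrow> 'a"
  assumes x_sphere: "x \<in> unit_sphere Y" and x_nonzero: "x i \<noteq> 0"
begin

lemma x_carr: "x \<in> carr Y" and nrm_x: "nrm Y x = 1"
  using x_sphere by (auto simp: unit_sphere_def)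

lemma npow_x: "npow x = 1"
  using nrm_Y_powr[OF x_carr] by (simp add: nrm_x)

lemma state_iff:
  "G \<in> state_space Y x \<longleftrightarrow> G \<in> carr (dual Y) \<and> (\<forall>z\<in>carr Y. norm (G z) \<le> nrm Y z) \<and> G x = 1"
  by (rule Y.state_space_iff[OF x_carr nrm_x])

lemma npow_restr_compl_x: "npow (restr (- A) x) = 1 - npow (restr A x)"
  using npow_restr_add[OF x_carr x_carr, of A, unfolded restr_split] npow_x by simp

lemma state_powr_le:
  assumes "G \<in> state_space Y x" "z \<in> carr Y"
  shows "norm (G z) powr p \<le> npow z"
proof -
  have "norm (G z) \<le> nrm Y z" using assms by (simp add: state_iff)
  then have "norm (G z) powr p \<le> nrm Y z powr p" using p_gt_1 by (intro powr_mono2) auto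
  then show ?thesis by (simp add: nrm_Y_powr assms)
qed

lemma state_le_1:
  assumes "G \<in> state_space Y x" "z \<in> carr Y" "npow z \<le> 1"
  shows "norm (G z) \<le> 1"
proof -
  have "norm (G z) \<le> nrm Y z" using assms by (simp add: state_iff)
  also have "nrm Y z \<le> 1"
    using assms(2,3) p_gt_1 npow_nonneg by (simp add: nrm_Y powr_le1)
  finally show ?thesis .
qed

text \<open>
  The function \<open>t \<mapsto> npow (x + t x\<^sub>A) - \<bar>1 + t Re G(x\<^sub>A)\<bar>\<^sup>p\<close>, where \<open>x\<^sub>A\<close> is the restriction of \<open>x\<close> to \<open>A\<close>,
  is nonnegative near 0 and vanishes at 0. Hence its derivative vanishes there, which determines the
  real part of \<open>G(x\<^sub>A)\<close>. For scalars in the class at hand \<open>inner 1\<close> is the real part.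
\<close>

lemma inner_state_restr:
  assumes G: "G \<in> state_space Y x"
  shows "inner 1 (G (restr A x)) = npow (restr A x)"
proof -
  define c where "c = npow (restr A x)"
  define r where "r = inner 1 (G (restr A x))"
  define f where "f t = c * (1 + t) powr p + (1 - c) - (1 + t * r) powr p" for t
  have Gd: "G \<in> carr (dual Y)" and Gx: "G x = 1" using G by (auto simp: state_iff)
  have f_nonneg: "0 \<le> f t" if t: "0 < 1 + t" "0 < 1 + t * r" for t
  proof -
    let ?c = "of_real (1 + t) :: 'k"
    let ?z = "restr A (smul Y ?c x) + restr (- A) x"
    have carrs: "restr A x \<in> carr Y" "restr (- A) x \<in> carr Y" "smul Y ?c (restr A x) \<in> carr Y"
      by (simp_all only: restr_carr smul_carr_Y x_carr)
    have z: "?z \<in> carr Y"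
      by (intro add_carr_Y restr_carr smul_carr_Y x_carr)
    have "G (restr A x) + G (restr (- A) x) = 1"
      using dual_add[OF Gd carrs(1,2)] by (simp add: restr_split Gx)
    moreover have "G ?z = ?c * G (restr A x) + G (restr (- A) x)"
      unfolding smul_restr[symmetric] by (simp only: dual_add[OF Gd carrs(3,2)] dual_smul[OF Gd carrs(1)])
    ultimately have "G ?z = 1 + of_real t * G (restr A x)"
      by (simp add: algebra_simps)
    then have "inner 1 (G ?z) = 1 + t * r"
      by (simp add: inner_add_right inner_one_one r_def scaleR_conv_of_real[symmetric])
    then have "1 + t * r \<le> norm (G ?z)"
      using inner_one_le_norm[of "G ?z"] by simp
    then have "(1 + t * r) powr p \<le> norm (G ?z) powr p"
      using t p_gt_1 by (intro powr_mono2) auto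
    also have "\<dots> \<le> npow ?z" by (rule state_powr_le[OF G z])
    also have "\<dots> = npow (smul Y ?c (restr A x)) + npow (restr (- A) x)"
      unfolding smul_restr by (intro npow_restr_add smul_carr_Y x_carr)
    also have "\<dots> = norm ?c powr p * c + (1 - c)"
      by (simp only: npow_smul carrs(1) npow_restr_compl_x c_def)
    also have "norm ?c = 1 + t" unfolding norm_of_real using t by simp
    finally show ?thesis by (simp add: f_def mult.commute)
  qed
  \<comment> \<open>keeps both bases of the powers in \<open>f\<close> positive\<close>
  define d where "d = 1 / (1 + \<bar>r\<bar>)"
  have d: "0 < d" by (simp add: d_def add_pos_nonneg)
  have "0 \<le> f t" if "\<bar>t\<bar> < d" for t
  proof (rule f_nonneg)
    have le: "\<bar>t\<bar> * (1 + \<bar>r\<bar>) < 1"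
      using that by (simp add: d_def pos_less_divide_eq add_pos_nonneg)
    have "\<bar>t\<bar> * 1 \<le> \<bar>t\<bar> * (1 + \<bar>r\<bar>)" "\<bar>t\<bar> * \<bar>r\<bar> \<le> \<bar>t\<bar> * (1 + \<bar>r\<bar>)"
      by (intro mult_left_mono; simp)+
    with le have "\<bar>t\<bar> < 1" "\<bar>t * r\<bar> < 1" by (simp_all add: abs_mult)
    then show "0 < 1 + t" "0 < 1 + t * r" by linarith+
  qed
  moreover have "f 0 = 0" by (simp add: f_def)
  moreover have "DERIV f 0 :> c * p - p * r"
    unfolding f_def by (auto intro!: derivative_eq_intros)
  ultimately have "c * p - p * r = 0"
    using d DERIV_local_min[of f "c * p - p * r" 0 d] by simp
  then show ?thesis using p_gt_1 by (simp add: c_def r_def)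
qed

text \<open>
  Replacing \<open>x\<close> on \<open>A\<close> by a sequence that is no larger there does not increase the norm. With the two
  parts rotated so that \<open>G\<close> is nonnegative on each, the value of \<open>G\<close> is a sum of two absolute values
  that is at most 1, and the part outside \<open>A\<close> already contributes \<open>1 - npow (restr A x)\<close>.
\<close>

lemma norm_state_restr_le_npow:
  assumes G: "G \<in> state_space Y x" and z: "z \<in> carr Y"
    and le: "npow (restr A z) \<le> npow (restr A x)"
  shows "norm (G (restr A z)) \<le> npow (restr A x)"
proof -
  have Gd: "G \<in> carr (dual Y)" and Gx: "G x = 1" using G by (auto simp: state_iff)
  obtain \<theta> \<eta> where \<theta>: "norm \<theta> = 1" "\<theta> * G (restr A z) = of_real (norm (G (restr A z)))"
    and \<eta>: "norm \<eta> = 1" "\<eta> * G (restr (- A) x) = of_real (norm (G (restr (- A) x)))"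
    using exists_unit_rotation by metis
  let ?y = "restr A (smul Y \<theta> z) + restr (- A) (smul Y \<eta> x)"
  have carrs: "restr A z \<in> carr Y" "restr (- A) x \<in> carr Y" "restr A x \<in> carr Y"
      "smul Y \<theta> (restr A z) \<in> carr Y" "smul Y \<eta> (restr (- A) x) \<in> carr Y"
    by (simp_all only: restr_carr smul_carr_Y x_carr z)
  have "npow ?y = npow (smul Y \<theta> (restr A z)) + npow (smul Y \<eta> (restr (- A) x))"
    unfolding smul_restr by (intro npow_restr_add smul_carr_Y x_carr z)
  also have "\<dots> = npow (restr A z) + (1 - npow (restr A x))"
    by (simp add: npow_smul carrs \<theta> \<eta> npow_restr_compl_x)
  finally have "npow ?y \<le> 1" using le by simp
  moreover have "?y \<in> carr Y"
    by (intro add_carr_Y restr_carr smul_carr_Y x_carr z)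
  ultimately have "norm (G ?y) \<le> 1" by (intro state_le_1[OF G])
  moreover have "G ?y = of_real (norm (G (restr A z)) + norm (G (restr (- A) x)))"
    unfolding smul_restr[symmetric]
    by (simp only: dual_add[OF Gd carrs(4,5)] dual_smul[OF Gd carrs(1)] dual_smul[OF Gd carrs(2)]
        \<theta>(2) \<eta>(2) of_real_add)
  ultimately have "norm (G (restr A z)) + norm (G (restr (- A) x)) \<le> 1"
    by (simp only: norm_of_real)
  moreover have "inner 1 (G (restr (- A) x)) = 1 - npow (restr A x)"
    by (simp only: inner_state_restr[OF G] npow_restr_compl_x)
  ultimately show ?thesis using inner_one_le_norm[of "G (restr (- A) x)"] by simp
qed

text \<open>
  The real part and the bound for the absolute value coincide, so the imaginary part is 0.
\<close>

lemma state_restr: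
  assumes G: "G \<in> state_space Y x"
  shows "G (restr A x) = of_real (npow (restr A x))"
proof -
  let ?a = "G (restr A x)" and ?c = "npow (restr A x)"
  have c: "0 \<le> ?c" by (intro npow_nonneg restr_carr x_carr)
  have "(norm (?a - of_real ?c))\<^sup>2 = (norm ?a)\<^sup>2 - 2 * ?c * inner 1 ?a + ?c\<^sup>2"
    unfolding power2_norm_eq_inner of_real_def inner_diff_left inner_diff_right
      inner_scaleR_left inner_scaleR_right inner_one_one inner_commute[of ?a 1]
    by (simp add: power2_eq_square algebra_simps)
  also have "\<dots> = (norm ?a)\<^sup>2 - ?c\<^sup>2"
    by (simp add: inner_state_restr[OF G] power2_eq_square)
  also have "\<dots> \<le> 0"
    using norm_state_restr_le_npow[OF G x_carr order_refl] c by (simp add: power_mono)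
  finally show ?thesis by simp
qed

lemma npow_restr_x_pos:
  assumes "i \<in> A" shows "0 < npow (restr A x)"
proof -
  have "0 < norm (x i) powr p" using x_nonzero by simp
  also have "\<dots> = npow (restr {i} (restr A x))"
    using assms by (simp add: restr_singleton npow_emb) (simp add: restr_def)
  also have "\<dots> \<le> npow (restr A x)" by (intro npow_restr_le restr_carr x_carr)
  finally show ?thesis .
qed

text \<open>
  Homogeneity turns the previous bound into an estimate for the norm of \<open>G\<close> on sequences supported in
  \<open>A\<close>. The right-hand side does not depend on \<open>G\<close>: for a singleton \<open>A\<close> it limits the component of \<open>G\<close>,
  and for a tail it is what makes the tails of all states small at the same time.
\<close>

lemma norm_state_restr_le:
  assumes G: "G \<in> state_space Y x" and z: "z \<in> carr Y" and A: "A \<noteq> {}"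
  shows "norm (G (restr A z)) \<le> npow (restr A x) powr (1 - 1 / p) * nrm Y z"
proof -
  let ?c = "npow (restr A x)" and ?N = "nrm Y (restr A z)"
  have Gd: "G \<in> carr (dual Y)" using G by (simp add: state_iff)
  have c: "0 < ?c" using A npow_restr_x_pos by blast
  have Az: "restr A z \<in> carr Y" by (intro restr_carr z)
  have "norm (G (restr A z)) \<le> ?c powr (1 - 1 / p) * ?N"
  proof (cases "?N = 0")
    case True
    have "norm (G (restr A z)) \<le> ?N" using G Az by (simp add: state_iff)
    with True show ?thesis by simp
  next
    case False
    then have N: "0 < ?N" using Y.nrm_nonneg[OF Az] by simp
    define k where "k = ?c powr (1 / p) / ?N"
    have k: "0 < k" using c N by (simp add: k_def)
    have "npow (restr A (smul Y (of_real k) z)) = (k * ?N) powr p"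
      using k N by (simp add: smul_restr[symmetric] npow_smul Az powr_mult nrm_Y_powr)
    also have "k * ?N = ?c powr (1 / p)" using N by (simp add: k_def)
    also have "\<dots> powr p = ?c" using p_gt_1 c by (simp add: powr_powr)
    finally have "norm (G (restr A (smul Y (of_real k) z))) \<le> ?c"
      by (intro norm_state_restr_le_npow[OF G]) (simp_all add: smul_carr_Y z)
    then have "k * norm (G (restr A z)) \<le> ?c"
      using k by (simp add: smul_restr[symmetric] dual_smul[OF Gd Az] norm_mult)
    then have "norm (G (restr A z)) \<le> ?c / ?c powr (1 / p) * ?N"
      using k N c by (simp add: k_def field_simps)
    also have "?c / ?c powr (1 / p) = ?c powr (1 - 1 / p)"
      using c by (simp add: powr_diff)
    finally show ?thesis .
  qed
  also have "\<dots> \<le> ?c powr (1 - 1 / p) * nrm Y z"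
    by (intro mult_left_mono nrm_Y_le Az z npow_restr_le) simp
  finally show ?thesis .
qed

end

section \<open>Slices of states\<close>

context lp_state
begin

text \<open>
  The common norm of the \<open>i\<close>-th components of all states at \<open>x\<close>.
\<close>

definition scaling :: "nat \<Rightarrow> real" where "scaling i = norm (x i) powr (p - 1)"

text \<open>
  The scalings are chosen so that \<open>coord_in i\<close> and \<open>coord_out i\<close> are inverse to each other on the
  \<open>i\<close>-th coordinate and that the adjoint of \<open>coord_in i\<close> yields the normalized \<open>i\<close>-th component.
\<close>

definition coord_in :: "nat \<Rightarrow> 'a \<Rightarrow> nat \<Rightarrow> 'a" where
  "coord_in i y = emb i (scl (of_real (inverse (scaling i))) y)"

definition coord_out :: "nat \<Rightarrow> (nat \<Rightarrow> 'a) \<Rightarrow> 'a" where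
  "coord_out i z = scl (of_real (scaling i)) (z i)"

abbreviation slice :: "nat \<Rightarrow> ((nat \<Rightarrow> 'a) \<Rightarrow> 'k) \<Rightarrow> 'a \<Rightarrow> 'k" where
  "slice i \<equiv> adjoint_on X (coord_in i)"

abbreviation direction :: "nat \<Rightarrow> 'a" where
  "direction i \<equiv> normalized X (x i)"

lemma scaling_pos: "0 < scaling i"
  using x_nonzero by (simp add: scaling_def)

lemma scaling_times_norm: "scaling i * norm (x i) = norm (x i) powr p"
  using x_nonzero powr_add[of "norm (x i)" "p - 1" 1] by (simp add: scaling_def)

lemma scl_inverse_scaling: "scl (of_real (inverse (scaling i))) (scl (of_real (scaling i)) y) = y"
  "scl (of_real (scaling i)) (scl (of_real (inverse (scaling i))) y) = y"
  using scaling_pos[of i] by (simp_all add: scale_of_real del: of_real_inverse)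

lemma bounded_operator_coord_in: "bounded_operator X Y (coord_in i)"
  unfolding coord_in_def by (rule bounded_operator_emb)

lemma bounded_operator_coord_out: "bounded_operator Y X (coord_out i)"
  unfolding coord_out_def by (rule bounded_operator_coord)

lemma coord_in_carr: "coord_in i y \<in> carr Y"
  by (simp add: coord_in_def emb_carr)

lemma slice_apply: "slice i G y = G (coord_in i y)"
  by (simp add: adjoint_on_apply)

lemma slice_coord_out: "slice i G (coord_out i z) = G (restr {i} z)"
  by (simp only: slice_apply coord_in_def coord_out_def scl_inverse_scaling restr_singleton)

lemma norm_direction: "norm (direction i) = 1"
  using x_nonzero by (simp add: normalized_def norm_scale norm_inverse norm_divide)

lemma direction_state_iff:
  "g \<in> state_space X (direction i) \<longleftrightarrow>
    g \<in> carr (dual X) \<and> (\<forall>y. norm (g y) \<le> norm y) \<and> g (direction i) = 1"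
  using X.state_space_iff[of "direction i" g] norm_direction by simp

lemma slice_dual: "G \<in> carr (dual Y) \<Longrightarrow> slice i G \<in> carr (dual X)"
  by (rule adjoint_on_dual[OF homogeneous_X homogeneous_Y bounded_operator_coord_in])

lemma state_emb_x:
  assumes "G \<in> state_space Y x"
  shows "G (emb i (x i)) = of_real (norm (x i) powr p)"
  using state_restr[OF assms, of "{i}"] by (simp add: restr_singleton npow_emb)

lemma slice_state:
  assumes G: "G \<in> state_space Y x"
  shows "slice i G \<in> state_space X (direction i)"
proof -
  have Gd: "G \<in> carr (dual Y)" using G by (simp add: state_iff)
  have "norm (slice i G y) \<le> norm y" for y
  proof -
    have "norm (slice i G y) \<le> npow (restr {i} x) powr (1 - 1 / p) * nrm Y (coord_in i y)"
      using norm_state_restr_le[OF G coord_in_carr[of i y], of "{i}"]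
      by (simp add: slice_apply restr_singleton) (simp add: coord_in_def emb_def)
    also have "npow (restr {i} x) powr (1 - 1 / p) = scaling i"
      using p_gt_1 by (simp add: restr_singleton npow_emb powr_powr scaling_def right_diff_distrib)
    also have "scaling i * nrm Y (coord_in i y) = norm y"
      using scaling_pos[of i]
      by (simp add: coord_in_def nrm_emb norm_scale del: of_real_inverse)
    finally show ?thesis .
  qed
  moreover have "slice i G (direction i) = 1"
  proof -
    have "coord_in i (direction i) =
        smul Y (of_real (inverse (scaling i) * inverse (norm (x i)))) (emb i (x i))"
      by (simp only: coord_in_def normalized_def X_simps emb_scl[symmetric] scale_scale of_real_mult)
    then have "slice i G (direction i) =
        of_real (inverse (scaling i) * inverse (norm (x i)) * norm (x i) powr p)"
      by (simp only: slice_apply dual_smul[OF Gd emb_carr] state_emb_x[OF G] of_real_mult)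
    also have "inverse (scaling i) * inverse (norm (x i)) * norm (x i) powr p = 1"
      using scaling_pos[of i] x_nonzero[of i]
      by (simp add: scaling_times_norm[symmetric] field_simps)
    finally show ?thesis by simp
  qed
  ultimately show ?thesis using slice_dual[OF Gd] by (simp add: direction_state_iff)
qed

text \<open>
  Exchanging one component of a functional; this is the affine section of \<open>slice i\<close> along which points
  of continuity are transferred.
\<close>

definition replace_slice ::
    "nat \<Rightarrow> ((nat \<Rightarrow> 'a) \<Rightarrow> 'k) \<Rightarrow> ('a \<Rightarrow> 'k) \<Rightarrow> (nat \<Rightarrow> 'a) \<Rightarrow> 'k" where
  "replace_slice i G g = adjoint_on Y (restr (- {i})) G + adjoint_on Y (coord_out i) g"

lemma replace_slice_apply:
  "z \<in> carr Y \<Longrightarrow> replace_slice i G g z = G (restr (- {i}) z) + g (coord_out i z)"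
  by (simp add: replace_slice_def adjoint_on_apply)

lemma replace_slice_dual:
  assumes "G \<in> carr (dual Y)" "g \<in> carr (dual X)"
  shows "replace_slice i G g \<in> carr (dual Y)"
  unfolding replace_slice_def
  by (intro homogeneous_nspace.add_carr[OF Y.homogeneous_nspace_dual] assms
      adjoint_on_dual[OF homogeneous_Y homogeneous_Y bounded_operator_restr]
      adjoint_on_dual[OF homogeneous_Y homogeneous_X bounded_operator_coord_out])

lemma slice_replace_slice:
  assumes "G \<in> carr (dual Y)"
  shows "slice i (replace_slice i G g) = g"
proof
  fix y
  have "restr (- {i}) (coord_in i y) = smul Y 0 (coord_in i y)"
    by (auto simp: restr_def coord_in_def emb_def smul_Y)
  then have "G (restr (- {i}) (coord_in i y)) = 0"
    using dual_smul[OF assms coord_in_carr, of 0] by simp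
  moreover have "coord_out i (coord_in i y) = y"
    using scl_inverse_scaling(2) by (simp add: coord_out_def coord_in_def emb_def)
  ultimately show "slice i (replace_slice i G g) y = g y"
    by (simp add: slice_apply replace_slice_apply coord_in_carr)
qed

lemma replace_slice_slice:
  assumes "G \<in> carr (dual Y)"
  shows "replace_slice i G (slice i G) = G"
proof
  fix z
  show "replace_slice i G (slice i G) z = G z"
  proof (cases "z \<in> carr Y")
    case True
    have "G (restr (- {i}) z) + G (restr {i} z) = G z"
      using dual_add[OF assms restr_carr[OF True, of "{i}"] restr_carr[OF True, of "- {i}"]]
      by (simp add: restr_split)
    then show ?thesis by (simp only: replace_slice_apply[OF True] slice_coord_out)
  next
    case False
    then show ?thesis by (simp add: replace_slice_def adjoint_on_def dual_outside[OF assms])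
  qed
qed

text \<open>
  Only the norm bound is at stake. On the \<open>i\<close>-th coordinate \<open>g\<close> is dominated by the value that \<open>G\<close>
  takes at the multiple of \<open>x i\<close> of the same norm, so \<open>G\<close> itself, evaluated at a sequence of the same
  norm as \<open>z\<close>, dominates the modified functional at \<open>z\<close>.
\<close>

lemma replace_slice_state:
  assumes G: "G \<in> state_space Y x" and g: "g \<in> state_space X (direction i)"
  shows "replace_slice i G g \<in> state_space Y x"
proof -
  have Gd: "G \<in> carr (dual Y)" using G by (simp add: state_iff)
  have gd: "g \<in> carr (dual X)" and g_le: "\<And>y. norm (g y) \<le> norm y" and g1: "g (direction i) = 1"
    using g by (auto simp: direction_state_iff)
  have "norm (replace_slice i G g z) \<le> nrm Y z" if z: "z \<in> carr Y" for z
  proof -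
    obtain \<theta> where \<theta>: "norm \<theta> = 1"
        "\<theta> * G (restr (- {i}) z) = of_real (norm (G (restr (- {i}) z)))"
      using exists_unit_rotation by metis
    \<comment> \<open>the sequence \<open>z\<close> with \<open>z i\<close> turned into the direction of \<open>x i\<close> and the rest rotated\<close>
    let ?r = "norm (z i) / norm (x i)"
    let ?y = "restr {i} (smul Y (of_real ?r) x) + restr (- {i}) (smul Y \<theta> z)"
    have carrs: "restr {i} x \<in> carr Y" "restr (- {i}) z \<in> carr Y"
        "smul Y (of_real ?r) (restr {i} x) \<in> carr Y" "smul Y \<theta> (restr (- {i}) z) \<in> carr Y"
      by (simp_all only: restr_carr smul_carr_Y x_carr z)
    have "G (restr {i} x) = of_real (norm (x i) powr p)"
      using state_emb_x[OF G] by (simp only: restr_singleton)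
    then have "G ?y = of_real (?r * norm (x i) powr p + norm (G (restr (- {i}) z)))"
      unfolding smul_restr[symmetric]
      by (simp only: dual_add[OF Gd carrs(3,4)] dual_smul[OF Gd carrs(1)] dual_smul[OF Gd carrs(2)]
          \<theta>(2) of_real_add of_real_mult)
    also have "?r * norm (x i) powr p = norm (coord_out i z)"
      using scaling_pos[of i] x_nonzero[of i]
      by (simp add: scaling_times_norm[symmetric] coord_out_def norm_scale)
    finally have Gy: "norm (coord_out i z) + norm (G (restr (- {i}) z)) \<le> norm (G ?y)"
      by (simp only: norm_of_real abs_ge_self)
    have y: "?y \<in> carr Y"
      by (intro add_carr_Y restr_carr smul_carr_Y x_carr z)
    have "npow ?y = npow (smul Y (of_real ?r) (restr {i} x)) + npow (smul Y \<theta> (restr (- {i}) z))"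
      unfolding smul_restr by (intro npow_restr_add smul_carr_Y x_carr z)
    also have "npow (smul Y (of_real ?r) (restr {i} x)) = npow (restr {i} z)"
      using x_nonzero[of i] by (simp add: restr_singleton emb_scl npow_smul emb_carr npow_emb
          powr_mult[symmetric] norm_divide)
    also have "npow (smul Y \<theta> (restr (- {i}) z)) = npow (restr (- {i}) z)"
      by (simp add: npow_smul carrs \<theta>)
    also have "npow (restr {i} z) + npow (restr (- {i}) z) = npow z"
      using npow_restr_add[OF z z, of "{i}", unfolded restr_split] by simp
    finally have "nrm Y ?y \<le> nrm Y z"
      by (intro nrm_Y_le y z eq_refl)
    moreover have "norm (G ?y) \<le> nrm Y ?y" using G y by (simp add: state_iff)
    moreover have "norm (replace_slice i G g z) \<le> norm (G (restr (- {i}) z)) + norm (coord_out i z)"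
      unfolding replace_slice_apply[OF z]
      by (rule order_trans[OF norm_triangle_ineq]) (simp add: g_le)
    ultimately show ?thesis using Gy by linarith
  qed
  moreover have "replace_slice i G g x = 1"
  proof -
    have "coord_out i x = smul X (of_real (scaling i * norm (x i))) (direction i)"
      using x_nonzero[of i] by (simp add: coord_out_def normalized_def scale_of_real del: of_real_mult of_real_inverse)
    then have "g (coord_out i x) = of_real (norm (x i) powr p)"
      using dual_smul[OF gd, of "direction i" "of_real (scaling i * norm (x i))"]
      by (simp add: g1 scaling_times_norm del: of_real_mult)
    moreover have "G (restr (- {i}) x) = of_real (1 - norm (x i) powr p)"
      by (simp only: state_restr[OF G] npow_restr_compl_x restr_singleton npow_emb)
    ultimately show ?thesis by (simp add: replace_slice_apply x_carr)
  qed
  ultimately show ?thesis using replace_slice_dual[OF Gd gd] by (simp add: state_iff)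
qed

lemma slice_weak_star_continuous:
  "continuous_map (weak_star_topology Y) (weak_star_topology X) (slice i)"
proof (rule weak_star_continuous_map)
  fix y
  show "\<exists>a. \<exists>z\<in>carr Y. \<forall>G\<in>carr (dual Y). slice i G y = a + G z"
    by (intro exI[of _ 0] bexI[of _ "coord_in i y"]) (auto simp: slice_apply coord_in_carr)
qed (use Y.zero_carr in \<open>auto simp: slice_dual\<close>)

lemma replace_slice_weak_star_continuous:
  assumes "G \<in> carr (dual Y)"
  shows "continuous_map (weak_star_topology X) (weak_star_topology Y) (replace_slice i G)"
proof (rule weak_star_continuous_map)
  fix z assume "z \<in> carr Y"
  then show "\<exists>a. \<exists>y\<in>carr X. \<forall>g\<in>carr (dual X). replace_slice i G g z = a + g y"
    by (auto simp: replace_slice_apply)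
qed (use Y.zero_carr in \<open>auto simp: replace_slice_dual assms\<close>)

lemma state_dual: "G \<in> state_space Y x \<Longrightarrow> G \<in> carr (dual Y)"
  and direction_state_dual: "g \<in> state_space X (direction i) \<Longrightarrow> g \<in> carr (dual X)"
  by (simp_all add: state_iff direction_state_iff)

lemma slice_continuous_at_if:
  assumes G: "G \<in> state_space Y x"
    and cont: "id_weak_star_weak_continuous_at Y (state_space Y x) G"
  shows "id_weak_star_weak_continuous_at X (state_space X (direction i)) (slice i G)"
proof (rule id_continuous_at_transfer[OF homogeneous_Y homogeneous_X])
  show "id_weak_star_weak_continuous_at Y (state_space Y x) (replace_slice i G (slice i G))"
    using cont by (simp only: replace_slice_slice[OF state_dual[OF G]])
  show "continuous_map (weak_star_topology X) (weak_star_topology Y) (replace_slice i G)"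
    by (intro replace_slice_weak_star_continuous state_dual G)
  show "bounded_operator (dual Y) (dual X) (slice i)"
    by (rule bounded_operator_adjoint_on[OF homogeneous_X homogeneous_Y bounded_operator_coord_in])
qed (use G in \<open>auto simp: state_dual direction_state_dual slice_state replace_slice_state
      slice_replace_slice\<close>)

abbreviation tail :: "nat \<Rightarrow> ((nat \<Rightarrow> 'a) \<Rightarrow> 'k) \<Rightarrow> (nat \<Rightarrow> 'a) \<Rightarrow> 'k" where
  "tail n \<equiv> adjoint_on Y (restr {n..})"

lemma tail_dual: "G \<in> carr (dual Y) \<Longrightarrow> tail n G \<in> carr (dual Y)"
  by (rule adjoint_on_dual[OF homogeneous_Y homogeneous_Y bounded_operator_restr])

lemma coord_out_adjoint_dual:
  "g \<in> carr (dual X) \<Longrightarrow> adjoint_on Y (coord_out i) g \<in> carr (dual Y)"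
  by (rule adjoint_on_dual[OF homogeneous_Y homogeneous_X bounded_operator_coord_out])

lemma tail_step:
  assumes G: "G \<in> carr (dual Y)"
  shows "tail n G = adjoint_on Y (coord_out n) (slice n G) + tail (Suc n) G"
proof
  fix z
  show "tail n G z = (adjoint_on Y (coord_out n) (slice n G) + tail (Suc n) G) z"
  proof (cases "z \<in> carr Y")
    case True
    have "restr {n..} z = restr {n} z + restr {Suc n..} z"
      by (auto simp: restr_def)
    then have "G (restr {n..} z) = G (restr {n} z) + G (restr {Suc n..} z)"
      by (simp only: dual_add[OF G restr_carr[OF True] restr_carr[OF True]])
    then show ?thesis by (simp add: adjoint_on_apply[OF True] slice_coord_out)
  qed (simp add: adjoint_on_def)
qed

lemma bidual_split:
  assumes \<Phi>: "\<Phi> \<in> carr (dual (dual Y))" and G: "G \<in> carr (dual Y)"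
  shows "\<Phi> G = (\<Sum>i<n. \<Phi> (adjoint_on Y (coord_out i) (slice i G))) + \<Phi> (tail n G)"
proof (induction n)
  case 0
  have "tail 0 G = G"
    by (auto simp: adjoint_on_def restr_def dual_outside[OF G])
  then show ?case by simp
next
  case (Suc n)
  have "\<Phi> (tail n G) = \<Phi> (adjoint_on Y (coord_out n) (slice n G)) + \<Phi> (tail (Suc n) G)"
    by (subst tail_step[OF G])
      (intro dual_add[OF \<Phi>] coord_out_adjoint_dual slice_dual tail_dual G)
  with Suc show ?case by simp
qed

lemma tails_uniformly_small:
  assumes \<Phi>: "\<Phi> \<in> carr (dual (dual Y))" and e: "0 < e"
  obtains n where "\<And>G. G \<in> state_space Y x \<Longrightarrow> norm (\<Phi> (tail n G)) < e"
proof -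
  let ?B = "nrm (dual (dual Y)) \<Phi>"
  let ?t = "\<lambda>n. npow (restr {n..} x) powr (1 - 1 / p)"
  interpret Yd: homogeneous_nspace "dual Y" by (rule Y.homogeneous_nspace_dual)
  have "?t \<longlonglongrightarrow> 0 powr (1 - 1 / p)"
    using p_gt_1 npow_nonneg[OF restr_carr[OF x_carr]]
    by (intro tendsto_powr2 npow_tail_tendsto_0 x_carr tendsto_const) auto
  then have "(\<lambda>n. ?B * ?t n) \<longlonglongrightarrow> ?B * 0"
    by (intro tendsto_mult tendsto_const) simp
  then have "\<forall>\<^sub>F n in sequentially. ?B * ?t n < e"
    using e by (intro order_tendstoD(2)[where y = "?B * 0"]) simp_all
  then obtain n where n: "?B * ?t n < e"
    by (auto simp: eventually_sequentially)
  show ?thesis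
  proof (rule that)
    fix G assume G: "G \<in> state_space Y x"
    have "nrm (dual Y) (tail n G) \<le> ?t n"
      by (rule Y.nrm_dual_le) (use norm_state_restr_le[OF G] in \<open>auto simp: adjoint_on_apply\<close>)
    then have "?B * nrm (dual Y) (tail n G) \<le> ?B * ?t n"
      by (intro mult_left_mono Yd.nrm_dual_nonneg \<Phi>)
    with Yd.dual_le_nrm[OF \<Phi> tail_dual[OF state_dual[OF G], of n]] n
    show "norm (\<Phi> (tail n G)) < e" by linarith
  qed
qed

text \<open>
  Up to an error that is uniformly small on the state space, a bidual element depends on finitely many
  slices only. Each of them is a point of continuity, and slicing is weak-star continuous, so that
  finitely many weak-star neighbourhoods can be intersected.
\<close>

lemma continuous_at_if_slices:
  assumes F: "F \<in> state_space Y x"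
    and cont: "\<And>i. id_weak_star_weak_continuous_at X (state_space X (direction i)) (slice i F)"
  shows "id_weak_star_weak_continuous_at Y (state_space Y x) F"
proof -
  have neX: "carr X \<noteq> {}" and neY: "carr Y \<noteq> {}" using Y.zero_carr by auto
  have KX: "state_space X (direction i) \<subseteq> carr (dual X)" for i
    using direction_state_dual by blast
  have KY: "state_space Y x \<subseteq> carr (dual Y)" using state_dual by blast
  show ?thesis
    unfolding id_continuous_at_iff[OF neY KY F]
  proof (intro ballI allI impI)
    fix \<Phi> and e :: real assume \<Phi>: "\<Phi> \<in> carr (dual (dual Y))" and e: "0 < e"
    obtain n where n: "\<And>G. G \<in> state_space Y x \<Longrightarrow> norm (\<Phi> (tail n G)) < e / 3"
      using tails_uniformly_small[OF \<Phi>, of "e / 3"] e by auto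
    define \<Psi> where "\<Psi> i = adjoint_on (dual X) (adjoint_on Y (coord_out i)) \<Phi>" for i
    have \<Psi>: "\<Psi> i \<in> carr (dual (dual X))" for i
      unfolding \<Psi>_def
      by (intro adjoint_on_dual[OF X.homogeneous_nspace_dual Y.homogeneous_nspace_dual _ \<Phi>]
          bounded_operator_adjoint_on[OF homogeneous_Y homogeneous_X bounded_operator_coord_out])
    have \<Psi>_slice: "\<Psi> i (slice i G) = \<Phi> (adjoint_on Y (coord_out i) (slice i G))"
      if "G \<in> state_space Y x" for i G
      using that by (simp add: \<Psi>_def adjoint_on_apply slice_dual state_dual)
    \<comment> \<open>a third of \<open>e\<close> for the \<open>n\<close> slices together and one for each of the two tails\<close>
    define d where "d = e / (3 * (real n + 1))"
    have d: "0 < d" using e by (simp add: d_def)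
    have "\<forall>i. \<exists>U. openin (weak_star_topology X) U \<and> slice i F \<in> U \<and>
        (\<forall>g\<in>U \<inter> state_space X (direction i). norm (\<Psi> i g - \<Psi> i (slice i F)) < d)"
      using cont \<Psi> d unfolding id_continuous_at_iff[OF neX KX slice_state[OF F]] by simp
    then obtain U where "\<forall>i. openin (weak_star_topology X) (U i) \<and> slice i F \<in> U i \<and>
        (\<forall>g\<in>U i \<inter> state_space X (direction i). norm (\<Psi> i g - \<Psi> i (slice i F)) < d)"
      unfolding choice_iff by (elim exE)
    then have U: "\<And>i. openin (weak_star_topology X) (U i)" "\<And>i. slice i F \<in> U i"
      "\<And>i g. g \<in> U i \<inter> state_space X (direction i) \<Longrightarrow> norm (\<Psi> i g - \<Psi> i (slice i F)) < d"
      by simp_all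
    define V where "V = topspace (weak_star_topology Y) \<inter>
        (\<Inter>i<n. {G \<in> topspace (weak_star_topology Y). slice i G \<in> U i})"
    have "openin (weak_star_topology Y) V"
      unfolding V_def
    proof (induction n)
      case (Suc n)
      have "openin (weak_star_topology Y) {G \<in> topspace (weak_star_topology Y). slice n G \<in> U n}"
        by (rule openin_continuous_map_preimage[OF slice_weak_star_continuous U(1)])
      from openin_Int[OF Suc this] show ?case
        by (rule back_subst[of "openin (weak_star_topology Y)"]) (auto simp: less_Suc_eq)
    qed simp
    moreover have "F \<in> V"
      using U(2) KY F by (auto simp: V_def topspace_weak_star_topology[OF neY])
    moreover have "norm (\<Phi> G - \<Phi> F) < e" if G: "G \<in> V \<inter> state_space Y x" for G
    proof -
      have GS: "G \<in> state_space Y x" and GU: "\<And>i. i < n \<Longrightarrow> slice i G \<in> U i"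
        using G by (auto simp: V_def)
      have "\<Phi> G - \<Phi> F = (\<Sum>i<n. \<Psi> i (slice i G) - \<Psi> i (slice i F)) + (\<Phi> (tail n G) - \<Phi> (tail n F))"
        using bidual_split[OF \<Phi> state_dual[OF GS], of n] bidual_split[OF \<Phi> state_dual[OF F], of n]
        by (simp add: \<Psi>_slice GS F sum_subtractf)
      then have "norm (\<Phi> G - \<Phi> F) \<le> norm (\<Sum>i<n. \<Psi> i (slice i G) - \<Psi> i (slice i F))
          + norm (\<Phi> (tail n G) - \<Phi> (tail n F))"
        by (simp add: norm_triangle_ineq)
      moreover have "norm (\<Phi> (tail n G) - \<Phi> (tail n F)) < e / 3 + e / 3"
        using norm_triangle_ineq4[of "\<Phi> (tail n G)" "\<Phi> (tail n F)"] n[OF GS] n[OF F] by linarith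
      moreover have "norm (\<Sum>i<n. \<Psi> i (slice i G) - \<Psi> i (slice i F)) \<le> (\<Sum>i<n. d)"
        using U(3)[OF IntI[OF GU slice_state[OF GS]]] by (intro sum_norm_le less_imp_le) auto
      moreover have "(\<Sum>i<n. d) \<le> e / 3"
        using e by (simp add: d_def divide_simps)
      ultimately show ?thesis by linarith
    qed
    ultimately show "\<exists>U. openin (weak_star_topology Y) U \<and> F \<in> U \<and>
        (\<forall>G\<in>U \<inter> state_space Y x. norm (\<Phi> G - \<Phi> F) < e)"
      by (intro exI[of _ V] conjI ballI)
  qed
qed

lemma normalized_component_eq_slice:
  assumes comps: "\<And>i. f i \<in> carr (dual X)" and state: "lp_functional p X f \<in> state_space Y x"
  shows "normalized (dual X) (f i) = slice i (lp_functional p X f)"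
proof -
  let ?F = "lp_functional p X f"
  have "?F (emb i y) = f i y" for y
  proof -
    have "f j (emb i y j) = (if j = i then f i y else 0)" for j
      using dual_smul[OF comps, of 0 j 0] by (simp add: emb_def)
    then have "(\<Sum>j. f j (emb i y j)) = f i y"
      using sums_single[of i "\<lambda>_. f i y"] by (simp add: sums_iff)
    then show ?thesis by (simp add: lp_functional_def emb_carr)
  qed
  then have slice: "slice i ?F y = of_real (inverse (scaling i)) * f i y" for y
    using dual_smul[OF comps, of y i "of_real (inverse (scaling i))"]
    by (simp add: slice_apply coord_in_def)
  then have "norm (f i y) = scaling i * norm (slice i ?F y)" for y
    using scaling_pos[of i] by (simp add: norm_mult norm_inverse norm_divide)
  moreover have "slice i ?F \<in> state_space X (direction i)"
    by (rule slice_state[OF state])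
  ultimately have "nrm (dual X) (f i) = scaling i"
    using scaling_pos[of i] norm_direction
    by (intro X.nrm_dual_eqI[OF comps, where u = "direction i"]) (auto simp: direction_state_iff)
  then show ?thesis
    by (simp add: normalized_def smul_dual fun_eq_iff slice del: of_real_inverse)
qed

end

section \<open>Points of continuity and their components\<close>

theorem theorem2p5:
  fixes scl :: "'k::real_or_complex \<Rightarrow> 'a::banach \<Rightarrow> 'a"
    and X :: "('k, 'a) nspace"
    and p q :: real
    and x :: "nat \<Rightarrow> 'a"
    and xs :: "nat \<Rightarrow> 'a \<Rightarrow> 'k"
  assumes "normed_vector_space scl"
    and "X = space_of scl"
    and "1 < p" and "1 / p + 1 / q = 1"
    and "x \<in> unit_sphere (lp_space p X)"
    and "\<And>i. x i \<noteq> 0"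
    and "xs \<in> carr (lp_space q (dual X))"
    and "lp_functional p X xs \<in> state_space (lp_space p X) x"
  shows "(\<forall>i. normalized (dual X) (xs i) \<in> state_space X (normalized X (x i))) \<and>
    (id_weak_star_weak_continuous_at (lp_space p X)
        (state_space (lp_space p X) x) (lp_functional p X xs)
     \<longleftrightarrow>
     (\<forall>i. weak_star_weak_PC X (state_space X (normalized X (x i))) (normalized (dual X) (xs i))))"
proof -
  interpret normed_vector_space scl by (rule assms(1))
  interpret lp_state scl p x
    using assms(3,5,6) by unfold_locales (simp_all add: assms(2))
  note X_def = assms(2)
  have state: "lp_functional p (space_of scl) xs \<in> state_space (lp_space p (space_of scl)) x"
    using assms(8) by (simp only: X_def)
  have comps: "xs i \<in> carr (dual (space_of scl))" for i
    using assms(7) by (simp add: lp_space_def X_def)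
  show ?thesis
    unfolding X_def weak_star_weak_PC_def normalized_component_eq_slice[OF comps state]
    using slice_state[OF state] slice_continuous_at_if[OF state] continuous_at_if_slices[OF state]
    by blast
qed

end
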